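(* Let $(M,J,g)$ be an almost complex manifold with Norden metric, let $t_1,t_2,t_3,t_4\in\mathbb{R}$, and let $\nabla'$ be the almost complex connection defined by $$ \begin{aligned} g\big(\nabla'_XY-\nabla_XY,Z\big)={}&\tfrac12F(X,JY,Z)+t_1\{F(Y,X,Z)+F(JY,JX,Z)\}\\ &+t_2\{F(Y,JX,Z)-F(JY,X,Z)\}+t_3\{F(Z,X,Y)+F(JZ,JX,Y)\}\\ &+t_4\{F(Z,JX,Y)-F(JZ,X,Y)\}. \end{aligned} $$ Then $\nabla'$ is natural if and only if $t_1=-t_3$ and $t_2=-t_4$, i.e. $$g\big(\nabla'_XY-\nabla_XY,Z\big)=\tfrac12F(X,JY,Z)+t_1N(Y,Z,JX)-t_2N(Y,Z,X)$$ for all vector fields $X,Y,Z$.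
   Context: An almost complex manifold with Norden metric $(M,J,g)$ is a $2n$-dimensional smooth manifold with an almost complex structure $J$ ($J^2X=-X$) and a pseudo-Riemannian metric $g$ such that $g(JX,JY)=-g(X,Y)$ for all vector fields $X,Y$. $\nabla$ is the Levi-Civita connection of $g$ and $F(X,Y,Z)=g((\nabla_XJ)Y,Z)$. The Nijenhuis tensor is $N(X,Y)=[JX,JY]-[X,Y]-J[JX,Y]-J[X,JY]=(\nabla_XJ)JY-(\nabla_YJ)JX+(\nabla_{JX}J)Y-(\nabla_{JY}J)X$, with $N(X,Y,Z)=g(N(X,Y),Z)$. A linear connection $\nabla'$ is called almost complex if $\nabla'J=0$, and natural if $\nabla'J=0$ and $\nabla'g=0$. Every connection of the displayed 4-parameter family is almost complex.
   Formalization: The "only if" part and the converse from the displayed formula are stated only when the cyclic sum of F does not vanish identically (not quasi-Kähler); otherwise, e.g. for F=0, every ∇' of the family is natural for all t1,...,t4. *)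

theory Defs
  imports "HOL-Analysis.Analysis" "HOL-Library.Function_Algebras"
begin

section \<open>Smooth manifolds\<close>

primrec Ck_on :: "nat \<Rightarrow> ('e::euclidean_space \<Rightarrow> 'f::real_normed_vector) \<Rightarrow> 'e set \<Rightarrow> bool" where
  "Ck_on 0 f S \<longleftrightarrow> continuous_on S f"
| "Ck_on (Suc k) f S \<longleftrightarrow>
     (\<forall>x\<in>S. f differentiable (at x)) \<and> (\<forall>v. Ck_on k (\<lambda>x. frechet_derivative f (at x) v) S)"

definition smooth_on :: "('e::euclidean_space \<Rightarrow> 'f::real_normed_vector) \<Rightarrow> 'e set \<Rightarrow> bool" where
  "smooth_on f S \<longleftrightarrow> (\<forall>k. Ck_on k f S)"

text \<open>The points of the manifold are the elements of a Hausdorff, second countable type; an atlas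
  is a set of charts (domain, coordinate map).\<close>

type_synonym ('a, 'e) chart = "'a set \<times> ('a \<Rightarrow> 'e)"

definition is_chart :: "('a::topological_space, 'e::euclidean_space) chart \<Rightarrow> bool" where
  "is_chart c \<longleftrightarrow> (case c of (U, \<phi>) \<Rightarrow>
     open U \<and> open (\<phi> ` U) \<and> homeomorphism U (\<phi> ` U) \<phi> (inv_into U \<phi>))"

definition smooth_manifold ::
  "nat \<Rightarrow> ('a::{t2_space,second_countable_topology}, 'e::euclidean_space) chart set \<Rightarrow> bool" where
  "smooth_manifold m A \<longleftrightarrow>
     DIM('e) = m \<and> (\<forall>c\<in>A. is_chart c) \<and> (\<Union>c\<in>A. fst c) = UNIV \<and>
     (\<forall>(U, \<phi>)\<in>A. \<forall>(V, \<psi>)\<in>A. smooth_on (\<psi> \<circ> inv_into U \<phi>) (\<phi> ` (U \<inter> V)))"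

definition smooth_functions ::
  "('a::{t2_space,second_countable_topology}, 'e::euclidean_space) chart set \<Rightarrow> ('a \<Rightarrow> real) set" where
  "smooth_functions A = {f. \<forall>(U, \<phi>)\<in>A. smooth_on (f \<circ> inv_into U \<phi>) (\<phi> ` U)}"

section \<open>Vector fields and connections\<close>

text \<open>Tangent vectors at \<open>p\<close> are the derivations at \<open>p\<close> of the algebra of smooth functions. They are
  set to \<open>0\<close> on non-smooth arguments so that equality of tangent vectors is equality in HOL.\<close>

type_synonym 'a tvector = "('a \<Rightarrow> real) \<Rightarrow> real"

type_synonym 'a vfield = "'a \<Rightarrow> 'a tvector"

definition tangent_space ::
  "('a::{t2_space,second_countable_topology}, 'e::euclidean_space) chart set \<Rightarrow> 'a \<Rightarrow> 'a tvector set" where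
  "tangent_space A p = {v.
     (\<forall>f\<in>smooth_functions A. \<forall>h\<in>smooth_functions A.
        v (\<lambda>q. f q + h q) = v f + v h \<and>
        v (\<lambda>q. f q * h q) = f p * v h + h p * v f) \<and>
     (\<forall>f\<in>smooth_functions A. \<forall>c. v (\<lambda>q. c * f q) = c * v f) \<and>
     (\<forall>f. f \<notin> smooth_functions A \<longrightarrow> v f = 0)}"

definition dderiv :: "'a vfield \<Rightarrow> ('a \<Rightarrow> real) \<Rightarrow> 'a \<Rightarrow> real" where
  "dderiv X f = (\<lambda>p. X p f)"

definition vector_fields ::
  "('a::{t2_space,second_countable_topology}, 'e::euclidean_space) chart set \<Rightarrow> 'a vfield set" where
  "vector_fields A = {X. (\<forall>p. X p \<in> tangent_space A p) \<and>
     (\<forall>f\<in>smooth_functions A. dderiv X f \<in> smooth_functions A)}"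

text \<open>Sums, differences and negatives of vector fields are the pointwise ones of
  \<^theory>\<open>HOL-Library.Function_Algebras\<close>.\<close>

definition fmult :: "('a \<Rightarrow> real) \<Rightarrow> 'a vfield \<Rightarrow> 'a vfield" where
  "fmult f X = (\<lambda>p h. f p * X p h)"

definition lie_bracket :: "'a vfield \<Rightarrow> 'a vfield \<Rightarrow> 'a vfield" where
  "lie_bracket X Y = (\<lambda>p f. X p (dderiv Y f) - Y p (dderiv X f))"

text \<open>\<open>D X Y\<close> is the covariant derivative of \<open>Y\<close> in the direction \<open>X\<close>.\<close>

definition linear_connection ::
  "('a::{t2_space,second_countable_topology}, 'e::euclidean_space) chart set \<Rightarrow>
   ('a vfield \<Rightarrow> 'a vfield \<Rightarrow> 'a vfield) \<Rightarrow> bool" where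
  "linear_connection A D \<longleftrightarrow>
     (\<forall>X\<in>vector_fields A. \<forall>Y\<in>vector_fields A. D X Y \<in> vector_fields A) \<and>
     (\<forall>X\<in>vector_fields A. \<forall>Y\<in>vector_fields A. \<forall>Z\<in>vector_fields A.
        D (X + Y) Z = D X Z + D Y Z \<and> D X (Y + Z) = D X Y + D X Z) \<and>
     (\<forall>f\<in>smooth_functions A. \<forall>X\<in>vector_fields A. \<forall>Y\<in>vector_fields A.
        D (fmult f X) Y = fmult f (D X Y) \<and>
        D X (fmult f Y) = fmult (dderiv X f) Y + fmult f (D X Y))"

section \<open>Tensor fields\<close>

text \<open>Tensor fields are given as maps on vector fields that are multilinear over the smooth
  functions. Accordingly non-degeneracy at a point is tested on values of vector fields; these
  exhaust the tangent space.\<close>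

definition almost_complex_structure ::
  "('a::{t2_space,second_countable_topology}, 'e::euclidean_space) chart set \<Rightarrow>
   ('a vfield \<Rightarrow> 'a vfield) \<Rightarrow> bool" where
  "almost_complex_structure A J \<longleftrightarrow>
     (\<forall>X\<in>vector_fields A. J X \<in> vector_fields A) \<and>
     (\<forall>X\<in>vector_fields A. \<forall>Y\<in>vector_fields A. J (X + Y) = J X + J Y) \<and>
     (\<forall>f\<in>smooth_functions A. \<forall>X\<in>vector_fields A. J (fmult f X) = fmult f (J X)) \<and>
     (\<forall>X\<in>vector_fields A. J (J X) = - X)"

definition pseudo_riemannian_metric ::
  "('a::{t2_space,second_countable_topology}, 'e::euclidean_space) chart set \<Rightarrow>
   ('a vfield \<Rightarrow> 'a vfield \<Rightarrow> 'a \<Rightarrow> real) \<Rightarrow> bool" where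
  "pseudo_riemannian_metric A g \<longleftrightarrow>
     (\<forall>X\<in>vector_fields A. \<forall>Y\<in>vector_fields A. g X Y \<in> smooth_functions A \<and> g X Y = g Y X) \<and>
     (\<forall>X\<in>vector_fields A. \<forall>Y\<in>vector_fields A. \<forall>Z\<in>vector_fields A.
        g (X + Y) Z = (\<lambda>p. g X Z p + g Y Z p)) \<and>
     (\<forall>f\<in>smooth_functions A. \<forall>X\<in>vector_fields A. \<forall>Y\<in>vector_fields A.
        g (fmult f X) Y = (\<lambda>p. f p * g X Y p)) \<and>
     (\<forall>p. \<forall>X\<in>vector_fields A. (\<forall>Y\<in>vector_fields A. g X Y p = 0) \<longrightarrow> (\<forall>f. X p f = 0))"

definition almost_complex_norden ::
  "nat \<Rightarrow> ('a::{t2_space,second_countable_topology}, 'e::euclidean_space) chart set \<Rightarrow>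
   ('a vfield \<Rightarrow> 'a vfield) \<Rightarrow> ('a vfield \<Rightarrow> 'a vfield \<Rightarrow> 'a \<Rightarrow> real) \<Rightarrow> bool" where
  "almost_complex_norden n A J g \<longleftrightarrow>
     smooth_manifold (2 * n) A \<and> almost_complex_structure A J \<and> pseudo_riemannian_metric A g \<and>
     (\<forall>X\<in>vector_fields A. \<forall>Y\<in>vector_fields A. \<forall>p. g (J X) (J Y) p = - g X Y p)"

definition nabla_J ::
  "('a vfield \<Rightarrow> 'a vfield \<Rightarrow> 'a vfield) \<Rightarrow> ('a vfield \<Rightarrow> 'a vfield) \<Rightarrow> 'a vfield \<Rightarrow> 'a vfield \<Rightarrow> 'a vfield" where
  "nabla_J D J X Y = D X (J Y) - J (D X Y)"

definition nabla_g ::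
  "('a vfield \<Rightarrow> 'a vfield \<Rightarrow> 'a vfield) \<Rightarrow> ('a vfield \<Rightarrow> 'a vfield \<Rightarrow> 'a \<Rightarrow> real) \<Rightarrow>
   'a vfield \<Rightarrow> 'a vfield \<Rightarrow> 'a vfield \<Rightarrow> 'a \<Rightarrow> real" where
  "nabla_g D g X Y Z = (\<lambda>p. dderiv X (g Y Z) p - g (D X Y) Z p - g Y (D X Z) p)"

definition levi_civita ::
  "('a::{t2_space,second_countable_topology}, 'e::euclidean_space) chart set \<Rightarrow>
   ('a vfield \<Rightarrow> 'a vfield \<Rightarrow> 'a \<Rightarrow> real) \<Rightarrow> ('a vfield \<Rightarrow> 'a vfield \<Rightarrow> 'a vfield) \<Rightarrow> bool" where
  "levi_civita A g D \<longleftrightarrow> linear_connection A D \<and>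
     (\<forall>X\<in>vector_fields A. \<forall>Y\<in>vector_fields A. D X Y - D Y X = lie_bracket X Y) \<and>
     (\<forall>X\<in>vector_fields A. \<forall>Y\<in>vector_fields A. \<forall>Z\<in>vector_fields A. \<forall>p. nabla_g D g X Y Z p = 0)"

definition almost_complex_connection ::
  "('a::{t2_space,second_countable_topology}, 'e::euclidean_space) chart set \<Rightarrow>
   ('a vfield \<Rightarrow> 'a vfield) \<Rightarrow> ('a vfield \<Rightarrow> 'a vfield \<Rightarrow> 'a vfield) \<Rightarrow> bool" where
  "almost_complex_connection A J D \<longleftrightarrow> linear_connection A D \<and>
     (\<forall>X\<in>vector_fields A. \<forall>Y\<in>vector_fields A. nabla_J D J X Y = 0)"

definition natural_connection ::
  "('a::{t2_space,second_countable_topology}, 'e::euclidean_space) chart set \<Rightarrow>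
   ('a vfield \<Rightarrow> 'a vfield) \<Rightarrow> ('a vfield \<Rightarrow> 'a vfield \<Rightarrow> 'a \<Rightarrow> real) \<Rightarrow>
   ('a vfield \<Rightarrow> 'a vfield \<Rightarrow> 'a vfield) \<Rightarrow> bool" where
  "natural_connection A J g D \<longleftrightarrow> almost_complex_connection A J D \<and>
     (\<forall>X\<in>vector_fields A. \<forall>Y\<in>vector_fields A. \<forall>Z\<in>vector_fields A. \<forall>p. nabla_g D g X Y Z p = 0)"

definition tensor_F ::
  "('a vfield \<Rightarrow> 'a vfield) \<Rightarrow> ('a vfield \<Rightarrow> 'a vfield \<Rightarrow> 'a \<Rightarrow> real) \<Rightarrow>
   ('a vfield \<Rightarrow> 'a vfield \<Rightarrow> 'a vfield) \<Rightarrow> 'a vfield \<Rightarrow> 'a vfield \<Rightarrow> 'a vfield \<Rightarrow> 'a \<Rightarrow> real" where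
  "tensor_F J g D X Y Z = g (nabla_J D J X Y) Z"

definition nijenhuis :: "('a vfield \<Rightarrow> 'a vfield) \<Rightarrow> 'a vfield \<Rightarrow> 'a vfield \<Rightarrow> 'a vfield" where
  "nijenhuis J X Y = lie_bracket (J X) (J Y) - lie_bracket X Y
     - J (lie_bracket (J X) Y) - J (lie_bracket X (J Y))"

definition tensor_N ::
  "('a vfield \<Rightarrow> 'a vfield) \<Rightarrow> ('a vfield \<Rightarrow> 'a vfield \<Rightarrow> 'a \<Rightarrow> real) \<Rightarrow>
   'a vfield \<Rightarrow> 'a vfield \<Rightarrow> 'a vfield \<Rightarrow> 'a \<Rightarrow> real" where
  "tensor_N J g X Y Z = g (nijenhuis J X Y) Z"

text \<open>Quasi-Kaehler manifolds with Norden metric: the class \<open>W\<^sub>3\<close> of the Ganchev--Borisov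
  classification (it contains the class \<open>W\<^sub>0\<close> of Kaehler manifolds with Norden metric, \<open>F = 0\<close>).
  \<open>D\<close> is meant to be the Levi-Civita connection of \<open>g\<close>. On exactly these manifolds every member of
  the 4-parameter family is natural, so there naturality does not constrain the parameters.\<close>

definition quasi_kaehler_norden ::
  "('a::{t2_space,second_countable_topology}, 'e::euclidean_space) chart set \<Rightarrow>
   ('a vfield \<Rightarrow> 'a vfield) \<Rightarrow> ('a vfield \<Rightarrow> 'a vfield \<Rightarrow> 'a \<Rightarrow> real) \<Rightarrow>
   ('a vfield \<Rightarrow> 'a vfield \<Rightarrow> 'a vfield) \<Rightarrow> bool" where
  "quasi_kaehler_norden A J g D \<longleftrightarrow>
     (\<forall>X\<in>vector_fields A. \<forall>Y\<in>vector_fields A. \<forall>Z\<in>vector_fields A. \<forall>p.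
        tensor_F J g D X Y Z p + tensor_F J g D Y Z X p + tensor_F J g D Z X Y p = 0)"

end

theory Submission
  imports Defs
begin

text \<open>
  Let \<open>T(X,Y,Z) = g(\<nabla>'\<^sub>X Y - \<nabla>\<^sub>X Y, Z)\<close>, so that \<open>\<nabla>'g = 0\<close> means that \<open>T\<close> is skew in its last two
  arguments. With \<open>P(X,Y,Z) = F(Y,X,Z) + F(Z,X,Y) + F(JY,JX,Z) + F(JZ,JX,Y)\<close> one has
  \<open>T(X,Y,Z) + T(X,Z,Y) = (t\<^sub>1 + t\<^sub>3) P(X,Y,Z) + (t\<^sub>2 + t\<^sub>4) P(JX,Y,Z)\<close>, and \<open>P(JJX,Y,Z) = - P(X,Y,Z)\<close>.
  So if \<open>T\<close> is skew, then \<open>((t\<^sub>1 + t\<^sub>3)\<^sup>2 + (t\<^sub>2 + t\<^sub>4)\<^sup>2) P = 0\<close>. Finally, \<open>P(X,Y,Z)\<close> equals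
  \<open>S(JX,JY,Z) + S(JX,Y,JZ)\<close> for the cyclic sum \<open>S\<close> of \<open>F\<close>. Since \<open>S\<close> is totally symmetric, \<open>P = 0\<close>
  lets \<open>J\<close> be moved from one argument of \<open>S\<close> to another at the cost of a sign; going once around
  the three arguments gives \<open>S = - S\<close>, so \<open>P = 0\<close> only if the manifold is quasi-Kaehler.
\<close>

section \<open>Sums of smooth functions and of vector fields\<close>

text \<open>The sum is a separate function \<open>h\<close>, prescribed on \<open>S\<close> only:
  derivatives are known to add only at points of \<open>S\<close>, and the induction hypothesis is
  applied to those derivatives.\<close>

lemma Ck_on_add_on:
  fixes S :: "'e::euclidean_space set" and f g h :: "'e \<Rightarrow> 'f::real_normed_vector"
  assumes "open S" "Ck_on k f S" "Ck_on k g S" "\<And>x. x \<in> S \<Longrightarrow> h x = f x + g x"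
  shows "Ck_on k h S"
  using assms(2-)
proof (induction k arbitrary: f g h)
  case 0
  then have "continuous_on S (\<lambda>x. f x + g x)"
    by (auto intro: continuous_on_add)
  with 0(3) show ?case
    by (simp cong: continuous_on_cong)
next
  case (Suc k)
  have deriv: "(h has_derivative
      (\<lambda>v. frechet_derivative f (at x) v + frechet_derivative g (at x) v)) (at x)"
    if x: "x \<in> S" for x
  proof (rule has_derivative_transform_within_open[OF _ \<open>open S\<close> x])
    show "((\<lambda>x. f x + g x) has_derivative
        (\<lambda>v. frechet_derivative f (at x) v + frechet_derivative g (at x) v)) (at x)"
      using Suc.prems(1,2) x
      by (intro has_derivative_add) (simp_all add: frechet_derivative_works[symmetric])
  qed (simp add: Suc.prems(3))
  show ?case
    unfolding Ck_on.simps
  proof (intro conjI ballI allI)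
    fix x assume "x \<in> S"
    then show "h differentiable at x"
      using deriv differentiable_def by blast
  next
    fix v
    show "Ck_on k (\<lambda>x. frechet_derivative h (at x) v) S"
    proof (rule Suc.IH)
      show "Ck_on k (\<lambda>x. frechet_derivative f (at x) v) S"
        "Ck_on k (\<lambda>x. frechet_derivative g (at x) v) S"
        using Suc.prems(1,2) by simp_all
    next
      fix x assume "x \<in> S"
      then show "frechet_derivative h (at x) v =
          frechet_derivative f (at x) v + frechet_derivative g (at x) v"
        by (simp add: frechet_derivative_at[OF deriv, symmetric])
    qed
  qed
qed

lemma smooth_functions_add:
  assumes A: "smooth_manifold m A" and f: "f \<in> smooth_functions A" and h: "h \<in> smooth_functions A"
  shows "(\<lambda>p. f p + h p) \<in> smooth_functions A"
  unfolding smooth_functions_def smooth_on_def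
proof (clarify)
  fix U \<phi> k assume c: "(U, \<phi>) \<in> A"
  have "is_chart (U, \<phi>)"
    using A c unfolding smooth_manifold_def by blast
  then have "open (\<phi> ` U)"
    by (simp add: is_chart_def)
  moreover have "Ck_on k (f \<circ> inv_into U \<phi>) (\<phi> ` U)" "Ck_on k (h \<circ> inv_into U \<phi>) (\<phi> ` U)"
    using f h c unfolding smooth_functions_def smooth_on_def by auto
  ultimately show "Ck_on k ((\<lambda>p. f p + h p) \<circ> inv_into U \<phi>) (\<phi> ` U)"
    by (rule Ck_on_add_on) simp
qed

lemma vector_fields_add:
  assumes A: "smooth_manifold m A" and X: "X \<in> vector_fields A" and Y: "Y \<in> vector_fields A"
  shows "X + Y \<in> vector_fields A"
  unfolding vector_fields_def
proof (clarify, intro conjI allI ballI)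
  fix p
  have "X p \<in> tangent_space A p" "Y p \<in> tangent_space A p"
    using X Y by (auto simp: vector_fields_def)
  then show "(X + Y) p \<in> tangent_space A p"
    unfolding tangent_space_def by (auto simp: algebra_simps)
next
  fix f assume "f \<in> smooth_functions A"
  then have "dderiv X f \<in> smooth_functions A" "dderiv Y f \<in> smooth_functions A"
    using X Y by (auto simp: vector_fields_def)
  from smooth_functions_add[OF A this] show "dderiv (X + Y) f \<in> smooth_functions A"
    by (simp add: dderiv_def)
qed

section \<open>The tensors F and N\<close>

locale norden_manifold =
  fixes n :: nat
    and A :: "('a::{t2_space,second_countable_topology}, 'e::euclidean_space) chart set"
    and J :: "'a vfield \<Rightarrow> 'a vfield"
    and g :: "'a vfield \<Rightarrow> 'a vfield \<Rightarrow> 'a \<Rightarrow> real"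
    and D :: "'a vfield \<Rightarrow> 'a vfield \<Rightarrow> 'a vfield"
  assumes norden: "almost_complex_norden n A J g"
    and levi_civita: "levi_civita A g D"
begin

abbreviation "VF \<equiv> vector_fields A"
abbreviation "F \<equiv> tensor_F J g D"
abbreviation "N \<equiv> tensor_N J g"

section \<open>Algebra of \<open>J\<close>, \<open>g\<close> and \<open>D\<close> on vector
  fields\<close>

lemma J_closed [simp]: "X \<in> VF \<Longrightarrow> J X \<in> VF"
  and J_add: "X \<in> VF \<Longrightarrow> Y \<in> VF \<Longrightarrow> J (X + Y) = J X + J Y"
  and J_J [simp]: "X \<in> VF \<Longrightarrow> J (J X) = - X"
  and g_sym: "X \<in> VF \<Longrightarrow> Y \<in> VF \<Longrightarrow> g X Y = g Y X"
  and g_add: "X \<in> VF \<Longrightarrow> Y \<in> VF \<Longrightarrow> Z \<in> VF \<Longrightarrow> g (X + Y) Z p = g X Z p + g Y Z p"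
  and g_nondegenerate: "X \<in> VF \<Longrightarrow> (\<And>Y. Y \<in> VF \<Longrightarrow> g X Y p = 0) \<Longrightarrow> X p f = 0"
  and g_J_J: "X \<in> VF \<Longrightarrow> Y \<in> VF \<Longrightarrow> g (J X) (J Y) p = - g X Y p"
  using norden
  unfolding almost_complex_norden_def almost_complex_structure_def pseudo_riemannian_metric_def
  by auto

lemma D_closed [simp]: "X \<in> VF \<Longrightarrow> Y \<in> VF \<Longrightarrow> D X Y \<in> VF"
  and D_add_left: "X \<in> VF \<Longrightarrow> Y \<in> VF \<Longrightarrow> Z \<in> VF \<Longrightarrow> D (X + Y) Z = D X Z + D Y Z"
  and D_add_right: "X \<in> VF \<Longrightarrow> Y \<in> VF \<Longrightarrow> Z \<in> VF \<Longrightarrow> D X (Y + Z) = D X Y + D X Z"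
  and D_torsion: "X \<in> VF \<Longrightarrow> Y \<in> VF \<Longrightarrow> lie_bracket X Y = D X Y - D Y X"
  and D_metric: "X \<in> VF \<Longrightarrow> Y \<in> VF \<Longrightarrow> Z \<in> VF \<Longrightarrow> nabla_g D g X Y Z p = 0"
  using levi_civita unfolding levi_civita_def linear_connection_def by auto

lemma add_closed [simp]: "X \<in> VF \<Longrightarrow> Y \<in> VF \<Longrightarrow> X + Y \<in> VF"
  using norden vector_fields_add unfolding almost_complex_norden_def by blast

text \<open>Closure under negation comes from \<open>J\<close>, because \<open>- X\<close> is
  \<open>J (J X)\<close>.\<close>

lemma minus_closed [simp]: "X \<in> VF \<Longrightarrow> - X \<in> VF"
  using J_J J_closed by metis

lemma diff_closed [simp]: "X \<in> VF \<Longrightarrow> Y \<in> VF \<Longrightarrow> X - Y \<in> VF"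
  using add_closed[of X "- Y"] by simp

lemma J_minus: "X \<in> VF \<Longrightarrow> J (- X) = - J X"
  by (metis J_J J_closed)

lemma J_diff: "X \<in> VF \<Longrightarrow> Y \<in> VF \<Longrightarrow> J (X - Y) = J X - J Y"
  using J_add[of X "- Y"] by (simp add: J_minus)

lemma g_diff: "X \<in> VF \<Longrightarrow> Y \<in> VF \<Longrightarrow> Z \<in> VF \<Longrightarrow> g (X - Y) Z p = g X Z p - g Y Z p"
  using g_add[of "X - Y" Y Z p] by simp

lemma g_minus:
  assumes [simp]: "X \<in> VF" "Z \<in> VF"
  shows "g (- X) Z p = - g X Z p"
proof -
  have [simp]: "0 \<in> VF" using diff_closed[of X X] by simp
  show ?thesis using g_diff[of X X Z p] g_diff[of 0 X Z p] by simp
qed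

lemma g_minus_right: "X \<in> VF \<Longrightarrow> Z \<in> VF \<Longrightarrow> g X (- Z) p = - g X Z p"
  using g_minus g_sym minus_closed by metis

text \<open>Self-adjointness of \<open>J\<close>: put \<open>J Y\<close> for \<open>Y\<close> in the
  Norden condition.\<close>

lemma g_J_left: "X \<in> VF \<Longrightarrow> Y \<in> VF \<Longrightarrow> g (J X) Y = g X (J Y)"
  using g_J_J[of X "J Y"] by (auto simp: g_minus_right fun_eq_iff)

lemma D_minus_left:
  assumes [simp]: "X \<in> VF" "Y \<in> VF"
  shows "D (- X) Y = - D X Y"
proof -
  have [simp]: "0 \<in> VF" using diff_closed[of X X] by simp
  show ?thesis using D_add_left[of X "- X" Y] D_add_left[of 0 0 Y]
    by (simp add: eq_neg_iff_add_eq_0 add.commute)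
qed

lemma D_minus_right:
  assumes [simp]: "X \<in> VF" "Y \<in> VF"
  shows "D X (- Y) = - D X Y"
proof -
  have [simp]: "0 \<in> VF" using diff_closed[of X X] by simp
  show ?thesis using D_add_right[of X Y "- Y"] D_add_right[of X 0 0]
    by (simp add: eq_neg_iff_add_eq_0 add.commute)
qed

section \<open>Symmetries of \<open>F\<close> and its relation to \<open>N\<close>\<close>

lemma F_eq: "X \<in> VF \<Longrightarrow> Y \<in> VF \<Longrightarrow> Z \<in> VF \<Longrightarrow> F X Y Z p = g (D X (J Y)) Z p - g (D X Y) (J Z) p"
  by (simp add: tensor_F_def nabla_J_def g_diff g_J_left)

lemma F_minus1: "X \<in> VF \<Longrightarrow> Y \<in> VF \<Longrightarrow> Z \<in> VF \<Longrightarrow> F (- X) Y Z p = - F X Y Z p"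
  and F_minus2: "X \<in> VF \<Longrightarrow> Y \<in> VF \<Longrightarrow> Z \<in> VF \<Longrightarrow> F X (- Y) Z p = - F X Y Z p"
  and F_minus3: "X \<in> VF \<Longrightarrow> Y \<in> VF \<Longrightarrow> Z \<in> VF \<Longrightarrow> F X Y (- Z) p = - F X Y Z p"
  by (simp_all add: F_eq J_minus D_minus_left D_minus_right g_minus g_minus_right)

text \<open>Subtract metric compatibility at \<open>Y, J Z\<close> from that at
  \<open>J Y, Z\<close>: the derivatives of \<open>g (J Y) Z\<close> and \<open>g Y (J Z)\<close>
  cancel because \<open>J\<close> is self-adjoint.\<close>

lemma F_sym:
  assumes [simp]: "X \<in> VF" "Y \<in> VF" "Z \<in> VF"
  shows "F X Y Z p = F X Z Y p"
  using D_metric[of X "J Y" Z p] D_metric[of X Y "J Z" p]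
  by (simp add: F_eq nabla_g_def g_J_left[of Y Z] g_sym[of Y "D X (J Z)"] g_sym[of "J Y" "D X Z"])

lemma F_J_J: "X \<in> VF \<Longrightarrow> Y \<in> VF \<Longrightarrow> Z \<in> VF \<Longrightarrow> F X (J Y) (J Z) p = F X Y Z p"
  by (simp add: F_eq D_minus_right g_minus g_minus_right)

lemma F_J_left: "X \<in> VF \<Longrightarrow> Y \<in> VF \<Longrightarrow> Z \<in> VF \<Longrightarrow> F X (J Y) Z p = - F X Y (J Z) p"
  using F_J_J[of X Y "J Z" p] by (simp add: F_minus3)

text \<open>Vanishing torsion turns each bracket into a difference of covariant derivatives; the
  eight resulting terms pair up into four values of \<open>nabla_J D J\<close>.\<close>

lemma N_eq:
  assumes [simp]: "X \<in> VF" "Y \<in> VF" "Z \<in> VF"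
  shows "N X Y Z p = F X (J Y) Z p - F Y (J X) Z p + F (J X) Y Z p - F (J Y) X Z p"
  by (simp add: tensor_N_def nijenhuis_def D_torsion g_diff J_diff g_minus g_J_left F_eq
      D_minus_right)

lemma N_skew:
  assumes "X \<in> VF" "Y \<in> VF" "Z \<in> VF"
  shows "N Y X Z p = - N X Y Z p"
  using assms by (simp add: N_eq)

lemma quasi_kaehler_if_sum_eq_0:
  assumes P: "\<And>X Y Z p. X \<in> VF \<Longrightarrow> Y \<in> VF \<Longrightarrow> Z \<in> VF \<Longrightarrow>
    F Y X Z p + F Z X Y p + F (J Y) (J X) Z p + F (J Z) (J X) Y p = 0"
  shows "quasi_kaehler_norden A J g D"
proof -
  define S where "S X Y Z p = F X Y Z p + F Y Z X p + F Z X Y p" for X Y Z p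
  have cyc: "S X Y Z p = S Y Z X p" for X Y Z p
    by (simp add: S_def)
  have S_minus: "S (- X) Y Z p = - S X Y Z p" if "X \<in> VF" "Y \<in> VF" "Z \<in> VF" for X Y Z p
    using that by (simp add: S_def F_minus1 F_minus2 F_minus3)
  \<comment> \<open>In the sum of the two sides' \<open>S\<close>-values the terms
    \<open>F (J X) (J Y) Z\<close> and \<open>F (J X) Y (J Z)\<close> cancel by
    \<open>F_J_left\<close>; the other four are those of \<open>P\<close>.\<close>
  have move_J: "S (J X) (J Y) Z p = - S (J X) Y (J Z) p"
    if [simp]: "X \<in> VF" "Y \<in> VF" "Z \<in> VF" for X Y Z p
    using P[of X Y Z p] F_J_J[of Z X Y p] F_J_J[of Y Z X p] F_J_left[of "J X" Y Z p]
      F_sym[of "J Y" Z "J X" p] F_sym[of Y X Z p]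
    by (simp add: S_def)
  \<comment> \<open>Putting \<open>J X\<close> for \<open>X\<close> turns the first argument into
    \<open>- X\<close>, which frees it of \<open>J\<close>.\<close>
  have move: "S X (J Y) Z p = - S X Y (J Z) p"
    if [simp]: "X \<in> VF" "Y \<in> VF" "Z \<in> VF" for X Y Z p
    using move_J[of "J X" Y Z p] by (simp add: S_minus)
  have S_J: "S X (J Y) Z p = 0" if [simp]: "X \<in> VF" "Y \<in> VF" "Z \<in> VF" for X Y Z p
  proof -
    have "S X (J Y) Z p = - S X Y (J Z) p" by (simp add: move)
    also have "\<dots> = - S Y (J Z) X p" using cyc[of X Y "J Z" p] by simp
    also have "\<dots> = S Y Z (J X) p" by (simp add: move)
    also have "\<dots> = S Z (J X) Y p" using cyc[of Y Z "J X" p] by simp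
    also have "\<dots> = - S Z X (J Y) p" by (simp add: move)
    also have "\<dots> = - S X (J Y) Z p" using cyc[of Z X "J Y" p] by simp
    finally show ?thesis by simp
  qed
  \<comment> \<open>Here \<open>J (J Y) = - Y\<close>; cyclic rotation brings the sign to the first
    slot, where \<open>S_minus\<close> applies.\<close>
  have "S X Y Z p = 0" if [simp]: "X \<in> VF" "Y \<in> VF" "Z \<in> VF" for X Y Z p
    using S_J[of X "J Y" Z p] S_minus[of Y Z X p] cyc[of X "- Y" Z p] cyc[of X Y Z p] by simp
  then show ?thesis
    by (simp add: quasi_kaehler_norden_def S_def)
qed

end

section \<open>The four-parameter family\<close>

locale norden_family = norden_manifold n A J g D
  for n :: nat
    and A :: "('a::{t2_space,second_countable_topology}, 'e::euclidean_space) chart set"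
    and J :: "'a vfield \<Rightarrow> 'a vfield"
    and g :: "'a vfield \<Rightarrow> 'a vfield \<Rightarrow> 'a \<Rightarrow> real"
    and D :: "'a vfield \<Rightarrow> 'a vfield \<Rightarrow> 'a vfield" +
  fixes D' :: "'a vfield \<Rightarrow> 'a vfield \<Rightarrow> 'a vfield"
    and t1 t2 t3 t4 :: real
  assumes connection: "linear_connection A D'"
    and family: "X \<in> VF \<Longrightarrow> Y \<in> VF \<Longrightarrow> Z \<in> VF \<Longrightarrow>
      g (D' X Y - D X Y) Z p =
        1/2 * F X (J Y) Z p
        + t1 * (F Y X Z p + F (J Y) (J X) Z p)
        + t2 * (F Y (J X) Z p - F (J Y) X Z p)
        + t3 * (F Z X Y p + F (J Z) (J X) Y p)
        + t4 * (F Z (J X) Y p - F (J Z) X Y p)"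
begin

abbreviation "T X Y Z \<equiv> g (D' X Y - D X Y) Z"

abbreviation "T_skew \<equiv> \<forall>X\<in>VF. \<forall>Y\<in>VF. \<forall>Z\<in>VF. \<forall>p. T X Y Z p + T X Z Y p = 0"

lemma D'_closed [simp]: "X \<in> VF \<Longrightarrow> Y \<in> VF \<Longrightarrow> D' X Y \<in> VF"
  using connection unfolding linear_connection_def by blast

text \<open>The term \<open>1/2 * F X (J Y) Z\<close> contributes \<open>- F X Y Z\<close> to the
  derivative of \<open>J\<close> and cancels that of \<open>D\<close>. Each of the four brackets is
  unchanged when \<open>J\<close> moves from \<open>Y\<close> to \<open>Z\<close>, so it contributes
  nothing.\<close>

lemma almost_complex: "almost_complex_connection A J D'"
  unfolding almost_complex_connection_def
proof (intro conjI ballI connection)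
  fix X Y assume [simp]: "X \<in> VF" "Y \<in> VF"
  have "g (nabla_J D' J X Y) Z p = 0" if [simp]: "Z \<in> VF" for Z p
  proof -
    have "g (nabla_J D' J X Y) Z p = F X Y Z p + T X (J Y) Z p - T X Y (J Z) p"
      by (simp add: F_eq nabla_J_def g_diff g_J_left)
    also have "\<dots> = 0"
      using F_J_left[of Y X Z p] F_J_left[of "J Y" X Z p] F_J_J[of "J Y" X Z p]
        F_J_J[of X Y Z p] F_J_J[of Y X Z p] F_J_left[of Z X Y p] F_J_J[of Z X Y p]
        F_J_left[of "J Z" X Y p] F_J_J[of "J Z" X Y p]
      by (simp add: family F_minus1 F_minus2 algebra_simps)
    finally show ?thesis .
  qed
  moreover have "nabla_J D' J X Y \<in> VF"
    by (simp add: nabla_J_def)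
  ultimately show "nabla_J D' J X Y = 0"
    by (auto simp: fun_eq_iff intro: g_nondegenerate)
qed

lemma natural_iff_skew: "natural_connection A J g D' \<longleftrightarrow> T_skew"
proof -
  have "nabla_g D' g X Y Z p = - (T X Y Z p + T X Z Y p)"
    if [simp]: "X \<in> VF" "Y \<in> VF" "Z \<in> VF" for X Y Z p
    using D_metric[of X Y Z p]
    by (simp add: nabla_g_def g_diff g_sym[of Y "D' X Z"] g_sym[of Y "D X Z"])
  then have "nabla_g D' g X Y Z p = 0 \<longleftrightarrow> T X Y Z p + T X Z Y p = 0"
    if "X \<in> VF" "Y \<in> VF" "Z \<in> VF" for X Y Z p
    using that by (simp only: neg_equal_0_iff_equal)
  then show ?thesis
    unfolding natural_connection_def by (simp add: almost_complex)
qed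

text \<open>The term \<open>1/2 * F X (J Y) Z\<close> is skew in \<open>Y\<close> and
  \<open>Z\<close> and drops out. Exchanging \<open>Y\<close> and \<open>Z\<close> swaps the
  brackets of \<open>t1\<close> and \<open>t3\<close>, and those of \<open>t2\<close> and
  \<open>t4\<close>.\<close>

lemma T_sum:
  assumes [simp]: "X \<in> VF" "Y \<in> VF" "Z \<in> VF"
  shows "T X Y Z p + T X Z Y p =
    (t1 + t3) * (F Y X Z p + F Z X Y p + F (J Y) (J X) Z p + F (J Z) (J X) Y p) +
    (t2 + t4) * (F Y (J X) Z p + F Z (J X) Y p - F (J Y) X Z p - F (J Z) X Y p)"
  using F_J_left[of X Y Z p] F_sym[of X Y "J Z" p] by (simp add: family algebra_simps)

lemma skew_imp_parameters:
  assumes skew: T_skew and nqk: "\<not> quasi_kaehler_norden A J g D"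
  shows "t1 = - t3 \<and> t2 = - t4"
proof (rule ccontr)
  assume "\<not> (t1 = - t3 \<and> t2 = - t4)"
  then have pos: "(t1 + t3)\<^sup>2 + (t2 + t4)\<^sup>2 \<noteq> 0"
    by (simp add: sum_power2_eq_zero_iff eq_neg_iff_add_eq_0)
  have "F Y X Z p + F Z X Y p + F (J Y) (J X) Z p + F (J Z) (J X) Y p = 0" (is "?P = 0")
    if [simp]: "X \<in> VF" "Y \<in> VF" "Z \<in> VF" for X Y Z p
  proof -
    \<comment> \<open>This is \<open>?P\<close> with \<open>J X\<close> in place of
      \<open>X\<close>.\<close>
    let ?Q = "F Y (J X) Z p + F Z (J X) Y p - F (J Y) X Z p - F (J Z) X Y p"
    have 1: "(t1 + t3) * ?P + (t2 + t4) * ?Q = 0"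
      using skew T_sum[of X Y Z p] by simp
    \<comment> \<open>The relation \<open>1\<close> at \<open>J X\<close>: replacing
      \<open>X\<close> again turns \<open>?Q\<close> into \<open>- ?P\<close>. Eliminating
      \<open>?Q\<close> from the two relations leaves the sum of squares times
      \<open>?P\<close>.\<close>
    have "(t1 + t3) * ?Q - (t2 + t4) * ?P = T (J X) Y Z p + T (J X) Z Y p"
      by (simp add: T_sum F_minus2 algebra_simps)
    also have "\<dots> = 0"
      using skew by simp
    finally have 2: "(t1 + t3) * ?Q - (t2 + t4) * ?P = 0" .
    have "((t1 + t3)\<^sup>2 + (t2 + t4)\<^sup>2) * ?P =
        (t1 + t3) * ((t1 + t3) * ?P + (t2 + t4) * ?Q) -
        (t2 + t4) * ((t1 + t3) * ?Q - (t2 + t4) * ?P)"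
      by algebra
    also have "\<dots> = 0"
      unfolding 1 2 by simp
    finally show ?thesis
      using pos mult_eq_0_iff by blast
  qed
  then show False
    using quasi_kaehler_if_sum_eq_0 nqk by blast
qed

lemma parameters_imp_skew: "t1 = - t3 \<and> t2 = - t4 \<Longrightarrow> T_skew"
  by (simp add: T_sum)

text \<open>With opposite parameters the brackets of \<open>t1\<close> and \<open>t3\<close> combine
  to \<open>N Y Z (J X)\<close>, and those of \<open>t2\<close> and \<open>t4\<close> to
  \<open>- N Y Z X\<close>.\<close>

lemma parameters_imp_T_eq:
  assumes "t1 = - t3 \<and> t2 = - t4" and [simp]: "X \<in> VF" "Y \<in> VF" "Z \<in> VF"
  shows "T X Y Z p = 1/2 * F X (J Y) Z p + t1 * N Y Z (J X) p - t2 * N Y Z X p"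
  using assms(1) F_J_J[of Y Z X p] F_J_J[of Z Y X p] F_J_left[of Y X Z p] F_J_left[of Z X Y p]
    F_J_left[of "J Y" X Z p] F_J_left[of "J Z" X Y p]
    F_sym[of Y X Z p] F_sym[of Z X Y p] F_sym[of "J Y" X Z p] F_sym[of "J Z" X Y p]
    F_sym[of Y X "J Z" p] F_sym[of Z X "J Y" p] F_sym[of "J Y" "J X" Z p] F_sym[of "J Z" "J X" Y p]
  by (simp add: family N_eq algebra_simps)

text \<open>The displayed formula does not mention \<open>t3\<close> and \<open>t4\<close>; it
  determines them through the skewness of \<open>T\<close>, by \<open>skew_imp_parameters\<close>.
  Skewness comes from that of \<open>N\<close> in its first two arguments.\<close>

lemma T_eq_imp_skew:
  assumes T: "\<forall>X\<in>VF. \<forall>Y\<in>VF. \<forall>Z\<in>VF. \<forall>p.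
    T X Y Z p = 1/2 * F X (J Y) Z p + t1 * N Y Z (J X) p - t2 * N Y Z X p"
  shows T_skew
proof (intro ballI allI)
  fix X Y Z p assume [simp]: "X \<in> VF" "Y \<in> VF" "Z \<in> VF"
  show "T X Y Z p + T X Z Y p = 0"
    using T N_skew[of Y Z "J X" p] N_skew[of Y Z X p] F_J_left[of X Y Z p] F_sym[of X Y "J Z" p]
    by simp
qed

end

text \<open>The converses exclude quasi-Kaehler manifolds: there \<open>P\<close> vanishes with the
  cyclic sum of \<open>F\<close>, so every choice of parameters gives a natural connection.\<close>

theorem theorem2p2:
  fixes n :: nat
    and A :: "('a::{t2_space,second_countable_topology}, 'e::euclidean_space) chart set"
    and J :: "'a vfield \<Rightarrow> 'a vfield"
    and g :: "'a vfield \<Rightarrow> 'a vfield \<Rightarrow> 'a \<Rightarrow> real"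
    and D D' :: "'a vfield \<Rightarrow> 'a vfield \<Rightarrow> 'a vfield"
    and t1 t2 t3 t4 :: real
  defines "F \<equiv> tensor_F J g D" and "N \<equiv> tensor_N J g"
  assumes M: "almost_complex_norden n A J g"
    and LC: "levi_civita A g D"
    and conn: "linear_connection A D'"
    and family: "\<forall>X\<in>vector_fields A. \<forall>Y\<in>vector_fields A. \<forall>Z\<in>vector_fields A. \<forall>p.
      g (D' X Y - D X Y) Z p =
        1/2 * F X (J Y) Z p
        + t1 * (F Y X Z p + F (J Y) (J X) Z p)
        + t2 * (F Y (J X) Z p - F (J Y) X Z p)
        + t3 * (F Z X Y p + F (J Z) (J X) Y p)
        + t4 * (F Z (J X) Y p - F (J Z) X Y p)"
  defines "displayed \<equiv> (\<forall>X\<in>vector_fields A. \<forall>Y\<in>vector_fields A. \<forall>Z\<in>vector_fields A. \<forall>p.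
      g (D' X Y - D X Y) Z p =
        1/2 * F X (J Y) Z p + t1 * N Y Z (J X) p - t2 * N Y Z X p)"
  shows "(t1 = - t3 \<and> t2 = - t4 \<longrightarrow> natural_connection A J g D' \<and> displayed) \<and>
    (\<not> quasi_kaehler_norden A J g D \<longrightarrow>
      (natural_connection A J g D' \<longleftrightarrow> t1 = - t3 \<and> t2 = - t4) \<and>
      (t1 = - t3 \<and> t2 = - t4 \<longleftrightarrow> displayed))"
proof -
  interpret norden_family n A J g D D' t1 t2 t3 t4
    using M LC conn family by unfold_locales (simp_all add: F_def)
  show ?thesis
    using natural_iff_skew skew_imp_parameters parameters_imp_skew parameters_imp_T_eq T_eq_imp_skew
    unfolding displayed_def F_def N_def by blast
qed

end
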